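(* For any graph $G$ with $\gamma_t(G)=\frac{1}{2}\max\{\gamma_r(G),2\rho(G)\}$ and any noncomplete graph $H$, $$\gamma_r(G\circ H)=2\gamma_t(G).$$
   Context: Graphs are finite, simple and undirected. For a graph $G$, a function $f:V(G)\to\{0,1,2\}$ has weight $w(f)=\sum_{v\in V(G)}f(v)$; a vertex $v$ is undefended with respect to $f$ if $f(v)=0$ and $f(u)=0$ for every $u$ adjacent to $v$. The function $f$ is a weak Roman dominating function (WRDF) on $G$ if for every $v$ with $f(v)=0$ there is a vertex $u$ adjacent to $v$ with $f(u)\in\{1,2\}$ such that the function $f'$ defined by $f'(v)=1$, $f'(u)=f(u)-1$ and $f'(z)=f(z)$ for $z\notin\{u,v\}$ has no undefended vertices. The weak Roman domination number $\gamma_r(G)$ is the minimum weight of a WRDF on $G$. The lexicographic product $G\circ H$ has vertex set $V(G)\times V(H)$, and $(u,v)$ and $(x,y)$ are adjacent iff $ux\in E(G)$, or $u=x$ and $vy\in E(H)$. The total domination number $\gamma_t(G)$ is defined only for graphs $G$ with no isolated vertex (so the hypothesis presupposes this), as the minimum cardinality of a set $S\subseteq V(G)$ such that every vertex of $G$ is adjacent to at least one vertex of $S$. A $2$-packing of $G$ is a set $X\subseteq V(G)$ with $N[u]\cap N[v]=\emptyset$ for every pair of different vertices $u,v\in X$, where $N[u]$ is the closed neighbourhood of $u$; $\rho(G)$ is the maximum cardinality of a $2$-packing. *)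

theory Defs
  imports Complex_Main "Graph_Theory.Graph_Theory"
begin

text \<open>
  Finite simple undirected graphs are the graphs of the locale \<^locale>\<open>pair_graph\<close>: finite
  symmetric loop-free digraphs without parallel arcs, an edge \<open>uv\<close> being the two arcs
  \<open>(u,v)\<close> and \<open>(v,u)\<close>. The arrow notation for the adjacency relation comes with that library.
  The null graph is not excluded.
\<close>

definition lex_product ::
  "'a pair_pre_digraph \<Rightarrow> 'b pair_pre_digraph \<Rightarrow> ('a \<times> 'b) pair_pre_digraph" where
  "lex_product G H =
    \<lparr> pverts = pverts G \<times> pverts H,
      parcs = {((u, v), (x, y)) | u v x y.
        (u, v) \<in> pverts G \<times> pverts H \<and> (x, y) \<in> pverts G \<times> pverts H \<and>
        (u \<rightarrow>\<^bsub>with_proj G\<^esub> x \<or> u = x \<and> v \<rightarrow>\<^bsub>with_proj H\<^esub> y)} \<rparr>"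

lemma pair_graph_lex_product:
  assumes "pair_graph G" "pair_graph H"
  shows "pair_graph (lex_product G H)"
proof -
  interpret G: pair_graph G by fact
  interpret H: pair_graph H by fact
  have "parcs (lex_product G H) \<subseteq> (pverts G \<times> pverts H) \<times> (pverts G \<times> pverts H)"
    by (auto simp: lex_product_def)
  then have "finite (parcs (lex_product G H))"
    by (rule finite_subset) simp
  then show ?thesis
    by unfold_locales
      (auto simp: lex_product_def symmetric_def sym_def
        dest: G.arcs_symmetric H.arcs_symmetric G.no_loops' H.no_loops')
qed

definition undefended :: "'a pair_pre_digraph \<Rightarrow> ('a \<Rightarrow> nat) \<Rightarrow> 'a \<Rightarrow> bool" where
  "undefended G f v \<longleftrightarrow>
    v \<in> pverts G \<and> f v = 0 \<and> (\<forall>u. v \<rightarrow>\<^bsub>with_proj G\<^esub> u \<longrightarrow> f u = 0)"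

text \<open>
  A function on the vertex set is a total function on the vertex type whose values outside
  \<open>pverts G\<close> are irrelevant.
\<close>

definition wrdf :: "'a pair_pre_digraph \<Rightarrow> ('a \<Rightarrow> nat) \<Rightarrow> bool" where
  "wrdf G f \<longleftrightarrow>
    f \<in> pverts G \<rightarrow> {0, 1, 2} \<and>
    (\<forall>v \<in> pverts G. f v = 0 \<longrightarrow>
      (\<exists>u. v \<rightarrow>\<^bsub>with_proj G\<^esub> u \<and> f u \<in> {1, 2} \<and>
           \<not> (\<exists>z. undefended G (f(v := 1, u := f u - 1)) z)))"

definition weak_roman_domination_number :: "'a pair_pre_digraph \<Rightarrow> nat" where
  "weak_roman_domination_number G = (LEAST k. \<exists>f. wrdf G f \<and> k = (\<Sum>v \<in> pverts G. f v))"

text \<open>The \<open>LEAST\<close> is attained, witnessed by the constant function 1.\<close>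

lemma wrdf_const_one: "wrdf G (\<lambda>_. 1)"
  by (auto simp: wrdf_def)

definition no_isolated_vertex :: "'a pair_pre_digraph \<Rightarrow> bool" where
  "no_isolated_vertex G \<longleftrightarrow> (\<forall>v \<in> pverts G. \<exists>u. v \<rightarrow>\<^bsub>with_proj G\<^esub> u)"

definition total_dominating_set :: "'a pair_pre_digraph \<Rightarrow> 'a set \<Rightarrow> bool" where
  "total_dominating_set G S \<longleftrightarrow>
    S \<subseteq> pverts G \<and> (\<forall>v \<in> pverts G. \<exists>u \<in> S. v \<rightarrow>\<^bsub>with_proj G\<^esub> u)"

text \<open>
  The following number is meaningful only for graphs without isolated vertices: otherwise
  there is no total dominating set and the \<open>LEAST\<close> is unspecified.
\<close>

definition total_domination_number :: "'a pair_pre_digraph \<Rightarrow> nat" where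
  "total_domination_number G = (LEAST k. \<exists>S. total_dominating_set G S \<and> k = card S)"

lemma total_dominating_set_pverts:
  assumes "pair_graph G" "no_isolated_vertex G"
  shows "total_dominating_set G (pverts G)"
proof -
  interpret pair_graph G by fact
  show ?thesis
    using assms(2) by (fastforce simp: total_dominating_set_def no_isolated_vertex_def
        dest: in_arcsD2)
qed

definition closed_neighbourhood :: "'a pair_pre_digraph \<Rightarrow> 'a \<Rightarrow> 'a set" where
  "closed_neighbourhood G v = insert v {u. v \<rightarrow>\<^bsub>with_proj G\<^esub> u}"

definition two_packing :: "'a pair_pre_digraph \<Rightarrow> 'a set \<Rightarrow> bool" where
  "two_packing G X \<longleftrightarrow>
    X \<subseteq> pverts G \<and>
    (\<forall>u \<in> X. \<forall>v \<in> X. u \<noteq> v \<longrightarrow> closed_neighbourhood G u \<inter> closed_neighbourhood G v = {})"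

definition two_packing_number :: "'a pair_pre_digraph \<Rightarrow> nat" where
  "two_packing_number G = Max {card X | X. two_packing G X}"

text \<open>For a finite graph, the \<open>Max\<close> ranges over a finite nonempty set.\<close>

lemma two_packing_cards:
  assumes "pair_graph G"
  shows "finite {card X | X. two_packing G X}" "{card X | X. two_packing G X} \<noteq> {}"
proof -
  interpret pair_graph G by fact
  have "{card X | X. two_packing G X} \<subseteq> card ` Pow (pverts G)"
    by (auto simp: two_packing_def)
  then show "finite {card X | X. two_packing G X}"
    by (rule finite_subset) simp
  have "two_packing G {}"
    by (simp add: two_packing_def)
  then show "{card X | X. two_packing G X} \<noteq> {}"
    by auto
qed

definition complete_graph :: "'a pair_pre_digraph \<Rightarrow> bool" where
  "complete_graph G \<longleftrightarrow> (\<exists>n. K\<^bsub>n\<^esub> (with_proj G))"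

end

theory Submission
  imports Defs
begin

text \<open>
  Doubling a total dominating set inside one copy of \<open>G\<close> gives
  \<open>\<gamma>\<^sub>r(G \<circ> H) \<le> 2 \<gamma>\<^sub>t(G)\<close>.
  Conversely, summing a weak Roman dominating function of \<open>G \<circ> H\<close> over each copy of \<open>H\<close>, and
  truncating the sums at 2, yields one of \<open>G\<close>, so \<open>\<gamma>\<^sub>r(G) \<le> \<gamma>\<^sub>r(G \<circ> H)\<close>; and if
  \<open>H\<close> has two nonadjacent vertices, every such function has weight at least 2 on
  \<open>N[u] \<times> V(H)\<close>, so \<open>2 \<rho>(G) \<le> \<gamma>\<^sub>r(G \<circ> H)\<close>.
  The hypothesis says that the two bounds coincide.
\<close>

section \<open>The product graph, attained minima and maxima, nonadjacent pairs\<close>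

lemma pverts_lex_product [simp]: "pverts (lex_product G H) = pverts G \<times> pverts H"
  by (simp add: lex_product_def)

lemma parcs_lex_product_iff:
  "((u, v), (x, y)) \<in> parcs (lex_product G H) \<longleftrightarrow>
    u \<in> pverts G \<and> v \<in> pverts H \<and> x \<in> pverts G \<and> y \<in> pverts H \<and>
    ((u, x) \<in> parcs G \<or> u = x \<and> (v, y) \<in> parcs H)"
  by (auto simp: lex_product_def)

lemma weak_roman_domination_number_le:
  assumes "wrdf G f"
  shows "weak_roman_domination_number G \<le> (\<Sum>v \<in> pverts G. f v)"
  unfolding weak_roman_domination_number_def using assms by (intro Least_le) blast

lemma weak_roman_domination_number_attained:
  obtains f where "wrdf G f" "weak_roman_domination_number G = (\<Sum>v \<in> pverts G. f v)"
proof -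
  have "\<exists>f. wrdf G f \<and> weak_roman_domination_number G = (\<Sum>v \<in> pverts G. f v)"
    unfolding weak_roman_domination_number_def
    by (rule LeastI_ex) (use wrdf_const_one in blast)
  then show ?thesis
    using that by blast
qed

lemma total_domination_number_attained:
  assumes "pair_graph G" "no_isolated_vertex G"
  obtains S where "total_dominating_set G S" "total_domination_number G = card S"
proof -
  have "\<exists>S. total_dominating_set G S \<and> total_domination_number G = card S"
    unfolding total_domination_number_def
    by (rule LeastI_ex) (use total_dominating_set_pverts[OF assms] in blast)
  then show ?thesis
    using that by blast
qed

lemma two_packing_number_attained:
  assumes "pair_graph G"
  obtains X where "two_packing G X" "two_packing_number G = card X"
proof -
  have "two_packing_number G \<in> {card X | X. two_packing G X}"
    unfolding two_packing_number_def using two_packing_cards[OF assms] by (rule Max_in)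
  then show ?thesis
    using that by blast
qed

text \<open>The arcs of a loop-free graph form a subset of the off-diagonal pairs of vertices, and
  completeness is equality. A pair missing from the arcs also shows that the graph has a
  vertex.\<close>

lemma noncomplete_nonadjacent:
  assumes "pair_graph G" "\<not> complete_graph G"
  obtains a b where "a \<in> pverts G" "b \<in> pverts G" "a \<noteq> b" "(a, b) \<notin> parcs G"
proof -
  interpret pair_graph G by fact
  have "parcs G \<noteq> {(u, v). (u, v) \<in> pverts G \<times> pverts G \<and> u \<noteq> v}"
    using assms(2) by (simp add: complete_graph_def complete_digraph_pair_def)
  moreover have "parcs G \<subseteq> {(u, v). (u, v) \<in> pverts G \<times> pverts G \<and> u \<noteq> v}"
    using no_loops' by (auto dest: in_arcsD1 in_arcsD2)
  ultimately show ?thesis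
    using that by blast
qed

section \<open>Upper bound by total domination\<close>

text \<open>Adjacency in \<open>G\<close> alone makes \<open>(p, q)\<close> adjacent to
  \<open>(w, h)\<close> for every \<open>q\<close>, so \<open>S \<times> {h}\<close> totally
  dominates the product when \<open>S\<close> totally dominates \<open>G\<close>.\<close>

lemma weak_roman_domination_number_lex_product_le:
  assumes "pair_graph G" "pair_graph H" "no_isolated_vertex G" "h \<in> pverts H"
  shows "weak_roman_domination_number (lex_product G H) \<le> 2 * total_domination_number G"
proof -
  interpret G: pair_graph G by fact
  interpret H: pair_graph H by fact
  obtain S where S: "total_dominating_set G S" and cardS: "total_domination_number G = card S"
    using total_domination_number_attained[OF assms(1,3)] .
  have SG: "S \<subseteq> pverts G" and dom: "\<And>x. x \<in> pverts G \<Longrightarrow> \<exists>u \<in> S. (x, u) \<in> parcs G"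
    using S by (auto simp: total_dominating_set_def)
  \<comment> \<open>With value 2, a vertex that gives away one unit keeps the other, so all of
    \<open>S \<times> {h}\<close> stays positive after any move.\<close>
  define f :: "'a \<times> 'b \<Rightarrow> nat" where "f p = (if p \<in> S \<times> {h} then 2 else 0)" for p
  have "\<exists>w. v \<rightarrow>\<^bsub>with_proj (lex_product G H)\<^esub> w \<and> f w \<in> {1, 2} \<and>
      \<not> (\<exists>z. undefended (lex_product G H) (f(v := 1, w := f w - 1)) z)"
    if v: "v \<in> pverts (lex_product G H)" "f v = 0" for v
  proof -
    obtain x y where v_eq: "v = (x, y)" "x \<in> pverts G" "y \<in> pverts H"
      using v(1) by auto
    obtain u where u: "u \<in> S" "(x, u) \<in> parcs G"
      using dom v_eq(2) by blast
    have False if und: "undefended (lex_product G H) (f(v := 1, (u, h) := f (u, h) - 1)) z" for z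
    proof -
      obtain p q where z: "z = (p, q)" "p \<in> pverts G" "q \<in> pverts H"
        using und by (auto simp: undefended_def)
      obtain w where w: "w \<in> S" "(p, w) \<in> parcs G"
        using dom z(2) by blast
      have "(z, (w, h)) \<in> parcs (lex_product G H)"
        using z w SG assms(4) by (auto simp: parcs_lex_product_iff)
      then have "(f(v := 1, (u, h) := f (u, h) - 1)) (w, h) = 0"
        using und unfolding undefended_def with_proj_simps by blast
      then show False
        using w(1) u(1) by (auto simp: f_def split: if_splits)
    qed
    moreover have "(v, (u, h)) \<in> parcs (lex_product G H)"
      using v_eq u SG assms(4) by (auto simp: parcs_lex_product_iff)
    moreover have "f (u, h) \<in> {1, 2}"
      using u by (simp add: f_def)
    ultimately show ?thesis
      by (intro exI[of _ "(u, h)"]) auto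
  qed
  then have "wrdf (lex_product G H) f"
    unfolding wrdf_def by (auto simp: f_def)
  then have "weak_roman_domination_number (lex_product G H) \<le> (\<Sum>p \<in> pverts G \<times> pverts H. f p)"
    using weak_roman_domination_number_le by fastforce
  also have "\<dots> = (\<Sum>p \<in> S \<times> {h}. 2)"
    by (rule sum.mono_neutral_cong_right) (use SG assms(4) in \<open>auto simp: f_def\<close>)
  also have "\<dots> = 2 * card S"
    by (simp add: card_cartesian_product)
  finally show ?thesis
    using cardS by simp
qed

section \<open>Lower bound by the weak Roman domination number of \<open>G\<close>\<close>

text \<open>If \<open>f\<close> defends \<open>(u, h)\<close> by a unit from \<open>(x, y)\<close>,
  then \<open>g\<close> defends \<open>u\<close> by a unit from \<open>x\<close>. Truncation does no
  harm: a move takes one unit only, so \<open>x\<close> drops to 0 exactly if its copy of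
  \<open>H\<close> had total 1.\<close>

lemma weak_roman_domination_number_le_lex_product:
  assumes "pair_graph G" "pair_graph H" "pverts H \<noteq> {}"
  shows "weak_roman_domination_number G \<le> weak_roman_domination_number (lex_product G H)"
proof -
  interpret G: pair_graph G by fact
  interpret H: pair_graph H by fact
  obtain f where f: "wrdf (lex_product G H) f"
    and wt: "weak_roman_domination_number (lex_product G H) = (\<Sum>p \<in> pverts (lex_product G H). f p)"
    by (rule weak_roman_domination_number_attained)
  obtain h where h: "h \<in> pverts H"
    using assms(3) by blast
  define s where "s u = (\<Sum>k \<in> pverts H. f (u, k))" for u
  define g where "g u = min 2 (s u)" for u
  have s0: "s u = 0 \<longleftrightarrow> (\<forall>k \<in> pverts H. f (u, k) = 0)" for u
    by (simp add: s_def)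
  have g0: "g u = 0 \<longleftrightarrow> s u = 0" for u
    by (auto simp: g_def min_def)
  have "\<exists>x. u \<rightarrow>\<^bsub>with_proj G\<^esub> x \<and> g x \<in> {1, 2} \<and>
      \<not> (\<exists>z. undefended G (g(u := 1, x := g x - 1)) z)"
    if u: "u \<in> pverts G" "g u = 0" for u
  proof -
    have fu: "f (u, k) = 0" if "k \<in> pverts H" for k
      using u(2) that by (simp add: g0 s0)
    obtain x y where xy: "((u, h), (x, y)) \<in> parcs (lex_product G H)" "f (x, y) \<in> {1, 2}"
      and def: "\<And>z. \<not> undefended (lex_product G H)
        (f((u, h) := 1, (x, y) := f (x, y) - 1)) z"
      using f u(1) h fu[OF h] unfolding wrdf_def by fastforce
    let ?f = "f((u, h) := 1, (x, y) := f (x, y) - 1)"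
    let ?g = "g(u := 1, x := g x - 1)"
    have y: "y \<in> pverts H"
      using xy(1) by (simp add: parcs_lex_product_iff)
    \<comment> \<open>The copy of \<open>H\<close> at \<open>u\<close> carries only zeros and
      \<open>f (x, y)\<close> is positive, so \<open>x\<close> differs from
      \<open>u\<close>.\<close>
    have ux: "(u, x) \<in> parcs G"
      using xy fu[OF y] by (auto simp: parcs_lex_product_iff)
    then have xu: "(x, u) \<in> parcs G" and neq: "u \<noteq> x"
      using G.arcs_symmetric G.no_loops' by auto
    have sx: "s x = f (x, y) + (\<Sum>k \<in> pverts H - {y}. f (x, k))"
      unfolding s_def using y by (intro sum.remove) auto
    have "1 \<le> s x"
      using xy(2) sx by auto
    then have gx: "g x \<in> {1, 2}"
      by (cases "s x = 1") (auto simp: g_def)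
    have False if und: "undefended G ?g z" for z
    proof -
      have z: "z \<in> pverts G" "?g z = 0" and nb: "\<And>w. (z, w) \<in> parcs G \<Longrightarrow> ?g w = 0"
        using und by (auto simp: undefended_def)
      \<comment> \<open>After the move \<open>u\<close> holds 1, so an undefended \<open>z\<close>
        is neither \<open>u\<close> nor a neighbour of \<open>u\<close>. Hence it is not
        \<open>x\<close> either, and the move leaves the all-zero copy at \<open>z\<close>
        unchanged.\<close>
      have zu: "(z, u) \<notin> parcs G"
        using nb[of u] neq by auto
      then have zx: "z \<noteq> x"
        using xu by blast
      have "z \<noteq> u"
        using z(2) neq by auto
      then have gz: "g z = 0"
        using z(2) zx by simp
      have fz: "f (z, k) = 0" if "k \<in> pverts H" for k
        using gz that by (simp add: g0 s0)
      have fz': "?f (z, k) = 0" if "k \<in> pverts H" for k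
        using fz[OF that] zx \<open>z \<noteq> u\<close> by simp
      \<comment> \<open>Since \<open>(z, h)\<close> is defended in the product after the move of
        \<open>f\<close>, it has a positive neighbour. This lies outside the copy at
        \<open>z\<close>, which is zero, so \<open>w\<close> is a neighbour of \<open>z\<close> in
        \<open>G\<close>.\<close>
      obtain w k where wk: "((z, h), (w, k)) \<in> parcs (lex_product G H)" "?f (w, k) \<noteq> 0"
        using def[of "(z, h)"] z(1) h fz'[OF h]
        by (auto simp: undefended_def simp del: fun_upd_apply)
      have k: "k \<in> pverts H"
        using wk(1) by (simp add: parcs_lex_product_iff)
      have zw: "(z, w) \<in> parcs G"
        using wk fz'[OF k] by (auto simp: parcs_lex_product_iff simp del: fun_upd_apply)
      have wu: "w \<noteq> u"
        using zw zu by blast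
      have gw: "?g w = 0"
        using nb[OF zw] .
      show False
      proof (cases "w = x")
        case False
        then have "g w = 0" "f (w, k) \<noteq> 0"
          using gw wk(2) wu by auto
        then show False
          using k by (simp add: g0 s0)
      next
        case True
        \<comment> \<open>Some weight remains on the copy at \<open>x\<close> after a unit has left
          it: either \<open>f (x, y)\<close> was 2 or another vertex of the copy is positive. So
          \<open>x\<close> keeps 1 under \<open>g\<close> as well.\<close>
        have "s x \<ge> 2"
        proof (cases "k = y")
          case True
          then show ?thesis
            using wk(2) \<open>w = x\<close> sx by simp
        next
          case False
          then have "f (x, k) \<noteq> 0"
            using wk(2) \<open>w = x\<close> neq by simp
          moreover have "f (x, k) \<le> (\<Sum>k \<in> pverts H - {y}. f (x, k))"
            using False k by (intro member_le_sum) auto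
          ultimately show ?thesis
            using sx xy(2) by auto
        qed
        then show False
          using gw True neq by (simp add: g_def)
      qed
    qed
    then show ?thesis
      using ux gx by (intro exI[of _ x]) auto
  qed
  moreover have "min 2 n \<in> {0, 1, 2}" for n :: nat
    by auto
  then have "g \<in> pverts G \<rightarrow> {0, 1, 2}"
    by (simp add: g_def)
  ultimately have "wrdf G g"
    by (simp add: wrdf_def)
  then have "weak_roman_domination_number G \<le> (\<Sum>u \<in> pverts G. g u)"
    by (rule weak_roman_domination_number_le)
  also have "\<dots> \<le> (\<Sum>u \<in> pverts G. s u)"
    by (rule sum_mono) (simp add: g_def)
  also have "\<dots> = (\<Sum>p \<in> pverts G \<times> pverts H. f p)"
    by (simp add: s_def sum.cartesian_product)
  finally show ?thesis
    using wt by simp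
qed

section \<open>Lower bound by 2-packings\<close>

lemma (in pair_graph) closed_neighbourhood_subset:
  "v \<in> pverts G \<Longrightarrow> closed_neighbourhood G v \<subseteq> pverts G"
  by (auto simp: closed_neighbourhood_def dest: in_arcsD2)

text \<open>The closed neighbourhood of each \<open>(u, k)\<close> lies in \<open>?N\<close>. If
  \<open>?N\<close> had weight at most 1, one unit would have to serve two nonadjacent vertices of
  the copy of \<open>H\<close> at \<open>u\<close>: moved to one of them, it leaves the other
  undefended. Both would then have to be positive, which already gives weight 2.\<close>

lemma wrdf_lex_product_closed_neighbourhood_ge_two:
  assumes "pair_graph G" "pair_graph H" "\<not> complete_graph H"
    and f: "wrdf (lex_product G H) f" and u: "u \<in> pverts G"
  shows "2 \<le> (\<Sum>p \<in> closed_neighbourhood G u \<times> pverts H. f p)"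
proof (rule ccontr)
  assume "\<not> ?thesis"
  interpret G: pair_graph G by fact
  interpret H: pair_graph H by fact
  let ?N = "closed_neighbourhood G u \<times> pverts H"
  have fin: "finite ?N"
    using finite_subset[OF G.closed_neighbourhood_subset[OF u]] by simp
  have nb: "p \<in> ?N" if "((u, k), p) \<in> parcs (lex_product G H)" for k p
    using that by (cases p) (auto simp: parcs_lex_product_iff closed_neighbourhood_def)
  have unique: "f q = 0" if "p \<in> ?N" "q \<in> ?N" "f p > 0" "p \<noteq> q" for p q
  proof -
    have "f p + f q = (\<Sum>r \<in> {p, q}. f r)"
      using that by simp
    also have "\<dots> \<le> (\<Sum>r \<in> ?N. f r)"
      using that fin by (intro sum_mono2) auto
    finally show ?thesis
      using \<open>\<not> 2 \<le> _\<close> that(3) by simp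
  qed
  have small: "f p \<le> 1" if "p \<in> ?N" for p
  proof -
    have "f p \<le> (\<Sum>r \<in> ?N. f r)"
      using that fin by (intro member_le_sum) auto
    then show ?thesis
      using \<open>\<not> 2 \<le> _\<close> by simp
  qed
  have uN: "(u, k) \<in> ?N" if "k \<in> pverts H" for k
    using that by (simp add: closed_neighbourhood_def)
  have pos: "f (u, c) > 0"
    if c: "c \<in> pverts H" and d: "d \<in> pverts H" and "c \<noteq> d" "(c, d) \<notin> parcs H" for c d
  proof (rule ccontr)
    assume "\<not> f (u, c) > 0"
    then obtain p where p: "((u, c), p) \<in> parcs (lex_product G H)" "f p \<in> {1, 2}"
      and def: "\<And>z. \<not> undefended (lex_product G H) (f((u, c) := 1, p := f p - 1)) z"
      using f u c unfolding wrdf_def by fastforce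
    have pN: "p \<in> ?N"
      using nb[OF p(1)] .
    have fp: "f p = 1"
      using small[OF pN] p(2) by auto
    have "(d, c) \<notin> parcs H"
      using that(4) H.arcs_symmetric by blast
    \<comment> \<open>The guard \<open>p\<close> is adjacent to \<open>(u, c)\<close>, whereas
      \<open>(u, d)\<close> is not. So \<open>(u, d)\<close> has value 0, and once \<open>p\<close>
      is emptied the only positive vertex of \<open>?N\<close> is \<open>(u, c)\<close>.\<close>
    moreover have "p \<noteq> (u, d)"
      using p(1) that(4) by (auto simp: parcs_lex_product_iff dest: G.no_loops')
    ultimately have "undefended (lex_product G H) (f((u, c) := 1, p := f p - 1)) (u, d)"
      using u d that(3) fp unique[OF pN] nb uN[OF d]
      by (auto simp: undefended_def parcs_lex_product_iff dest: G.no_loops')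
    then show False
      using def by blast
  qed
  obtain a b where ab: "a \<in> pverts H" "b \<in> pverts H" "a \<noteq> b" "(a, b) \<notin> parcs H"
    using noncomplete_nonadjacent[OF assms(2,3)] .
  then have "(b, a) \<notin> parcs H"
    using H.arcs_symmetric by blast
  then have "f (u, a) > 0" "f (u, b) > 0"
    using pos ab by auto
  then show False
    using unique[of "(u, a)" "(u, b)"] uN ab by simp
qed

text \<open>The closed neighbourhoods of the members of a 2-packing are disjoint, so the local
  bounds of 2 add up.\<close>

lemma two_packing_number_le_lex_product:
  assumes "pair_graph G" "pair_graph H" "\<not> complete_graph H"
  shows "2 * two_packing_number G \<le> weak_roman_domination_number (lex_product G H)"
proof -
  interpret G: pair_graph G by fact
  interpret H: pair_graph H by fact
  obtain f where f: "wrdf (lex_product G H) f"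
    and wt: "weak_roman_domination_number (lex_product G H) = (\<Sum>p \<in> pverts (lex_product G H). f p)"
    by (rule weak_roman_domination_number_attained)
  obtain X where X: "two_packing G X" and cardX: "two_packing_number G = card X"
    using two_packing_number_attained[OF assms(1)] .
  let ?N = "\<lambda>u. closed_neighbourhood G u \<times> pverts H"
  have XG: "X \<subseteq> pverts G"
    using X by (simp add: two_packing_def)
  have NG: "?N u \<subseteq> pverts G \<times> pverts H" if "u \<in> X" for u
    using G.closed_neighbourhood_subset XG that by blast
  have "2 * card X = (\<Sum>u \<in> X. 2)"
    by simp
  also have "\<dots> \<le> (\<Sum>u \<in> X. \<Sum>p \<in> ?N u. f p)"
    using wrdf_lex_product_closed_neighbourhood_ge_two[OF assms f] XG by (intro sum_mono) blast
  also have "\<dots> = (\<Sum>p \<in> (\<Union>u \<in> X. ?N u). f p)"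
  proof (rule sum.UNION_disjoint[symmetric])
    show "finite X"
      using XG G.pair_finite_verts by (rule finite_subset)
    show "\<forall>u \<in> X. finite (?N u)"
      using finite_subset[OF NG] by simp
    show "\<forall>u \<in> X. \<forall>v \<in> X. u \<noteq> v \<longrightarrow> ?N u \<inter> ?N v = {}"
      using X unfolding two_packing_def by blast
  qed
  also have "\<dots> \<le> (\<Sum>p \<in> pverts G \<times> pverts H. f p)"
    using NG by (intro sum_mono2) auto
  finally show ?thesis
    using wt cardX by simp
qed

theorem theorem25:
  fixes G :: "'a pair_pre_digraph" and H :: "'b pair_pre_digraph"
  assumes "pair_graph G" and "pair_graph H"
    and "no_isolated_vertex G"
    and "real (total_domination_number G) =
      1 / 2 * real (max (weak_roman_domination_number G) (2 * two_packing_number G))"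
    and "\<not> complete_graph H"
  shows "weak_roman_domination_number (lex_product G H) = 2 * total_domination_number G"
proof (rule antisym)
  obtain h where h: "h \<in> pverts H"
    using noncomplete_nonadjacent[OF assms(2,5)] .
  show "weak_roman_domination_number (lex_product G H) \<le> 2 * total_domination_number G"
    using weak_roman_domination_number_lex_product_le[OF assms(1-3) h] .
  \<comment> \<open>Doubling the real equation of the hypothesis gives one between naturals; each
    argument of \<open>max\<close> is one of the two lower bounds.\<close>
  have "2 * total_domination_number G =
      max (weak_roman_domination_number G) (2 * two_packing_number G)"
    using assms(4) by linarith
  also have "\<dots> \<le> weak_roman_domination_number (lex_product G H)"
    using weak_roman_domination_number_le_lex_product[OF assms(1,2)]
      two_packing_number_le_lex_product[OF assms(1,2,5)] h
    by auto
  finally show "2 * total_domination_number G \<le> weak_roman_domination_number (lex_product G H)" .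
qed

end
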